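(* For every fixed $s\in\mathbb{N}$, $$\operatorname{ex}^\star(n, DS_{1, 2s+1}) = \frac{(2s+3)n}{2} + O(1),$$ where $O(1)$ denotes a term bounded in absolute value by a constant depending only on $s$ as $n\to\infty$.
   Context: Graphs are finite and simple, and all colorings are edge colorings. For $r,t\in\mathbb{N}$, the double star $DS_{r,t}$ is the tree formed by taking a single edge $yx$ and appending $r$ leaves to $y$ and $t$ leaves to $x$. A subgraph of an edge-colored graph is rainbow if all its edges have distinct colors. The rainbow Turán number $\operatorname{ex}^\star(n,F)$ is the largest number of edges among those $n$-vertex graphs that have at least one proper edge coloring containing no rainbow subgraph isomorphic to $F$ (subgraphs need not be induced). *)

theory Defs
  imports Complex_Main "HOL-Library.Landau_Symbols"
begin

record 'v graph =
  verts :: "'v set"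
  edges :: "'v set set"

definition simple_graph :: "'v graph \<Rightarrow> bool" where
  "simple_graph G \<longleftrightarrow>
     finite (verts G) \<and> (\<forall>e\<in>edges G. e \<subseteq> verts G \<and> card e = 2)"

definition subgraph :: "'v graph \<Rightarrow> 'v graph \<Rightarrow> bool" where
  "subgraph H G \<longleftrightarrow>
     simple_graph H \<and> verts H \<subseteq> verts G \<and> edges H \<subseteq> edges G"

definition graph_iso :: "'v graph \<Rightarrow> 'w graph \<Rightarrow> bool" where
  "graph_iso G H \<longleftrightarrow>
     (\<exists>f. bij_betw f (verts G) (verts H) \<and>
          (\<forall>u\<in>verts G. \<forall>v\<in>verts G. {u, v} \<in> edges G \<longleftrightarrow> {f u, f v} \<in> edges H))"

text \<open>Only the values of a coloring on the edges of the graph matter.  The graphs are finite, so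
  natural numbers provide enough colors.\<close>

definition proper_edge_coloring :: "'v graph \<Rightarrow> ('v set \<Rightarrow> nat) \<Rightarrow> bool" where
  "proper_edge_coloring G c \<longleftrightarrow>
     (\<forall>e\<in>edges G. \<forall>e'\<in>edges G. e \<noteq> e' \<and> e \<inter> e' \<noteq> {} \<longrightarrow> c e \<noteq> c e')"

definition rainbow :: "('v set \<Rightarrow> nat) \<Rightarrow> 'v graph \<Rightarrow> bool" where
  "rainbow c H \<longleftrightarrow> inj_on c (edges H)"

definition rainbow_free :: "'v graph \<Rightarrow> ('v set \<Rightarrow> nat) \<Rightarrow> 'w graph \<Rightarrow> bool" where
  "rainbow_free G c F \<longleftrightarrow> \<not> (\<exists>H. subgraph H G \<and> graph_iso H F \<and> rainbow c H)"

text \<open>Every finite graph is isomorphic to one whose vertices are natural numbers, so it is enough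
  to let the \<open>n\<close>-vertex graphs range over graphs of type \<^typ>\<open>nat graph\<close>.\<close>

definition rainbow_edge_counts :: "nat \<Rightarrow> 'w graph \<Rightarrow> nat set" where
  "rainbow_edge_counts n F =
     {card (edges G) | G :: nat graph.
        simple_graph G \<and> card (verts G) = n \<and>
        (\<exists>c. proper_edge_coloring G c \<and> rainbow_free G c F)}"

text \<open>The maximum is meaningful by \<open>finite_rainbow_edge_counts\<close> and
  \<open>rainbow_edge_counts_nonempty\<close> below, as soon as \<open>F\<close> has an edge.\<close>

definition rainbow_turan :: "nat \<Rightarrow> 'w graph \<Rightarrow> nat" where
  "rainbow_turan n F = Max (rainbow_edge_counts n F)"

datatype ds_vertex = CenterY | CenterX | LeafY nat | LeafX nat

definition double_star :: "nat \<Rightarrow> nat \<Rightarrow> ds_vertex graph" where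
  "double_star r t =
     \<lparr> verts = {CenterY, CenterX} \<union> LeafY ` {..<r} \<union> LeafX ` {..<t},
       edges = {{CenterY, CenterX}} \<union> (\<lambda>i. {CenterY, LeafY i}) ` {..<r}
                 \<union> (\<lambda>i. {CenterX, LeafX i}) ` {..<t} \<rparr>"

lemma simple_graph_double_star: "simple_graph (double_star r t)"
  by (auto simp: simple_graph_def double_star_def)

lemma finite_rainbow_edge_counts: "finite (rainbow_edge_counts n F)"
proof (rule finite_subset)
  show "rainbow_edge_counts n F \<subseteq> {..2 ^ n}"
  proof
    fix m assume "m \<in> rainbow_edge_counts n F"
    then obtain G :: "nat graph" where G: "simple_graph G" "card (verts G) = n" "m = card (edges G)"
      by (auto simp: rainbow_edge_counts_def)
    then have "finite (verts G)" "edges G \<subseteq> Pow (verts G)"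
      by (auto simp: simple_graph_def)
    then have "card (edges G) \<le> card (Pow (verts G))"
      by (intro card_mono) auto
    with G \<open>finite (verts G)\<close> show "m \<in> {..2 ^ n}"
      by (simp add: card_Pow)
  qed
qed simp

lemma rainbow_edge_counts_nonempty:
  assumes F: "simple_graph F" "edges F \<noteq> {}"
  shows "rainbow_edge_counts n F \<noteq> {}"
proof -
  define G :: "nat graph" where "G = \<lparr>verts = {..<n}, edges = {}\<rparr>"
  obtain u v where uv: "{u, v} \<in> edges F" "u \<in> verts F" "v \<in> verts F"
    using F by (fastforce simp: simple_graph_def card_2_iff)
  have "\<not> graph_iso H F" if "subgraph H G" for H
  proof
    assume "graph_iso H F"
    then obtain f where f: "bij_betw f (verts H) (verts F)"
      "\<forall>u\<in>verts H. \<forall>v\<in>verts H. {u, v} \<in> edges H \<longleftrightarrow> {f u, f v} \<in> edges F"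
      by (auto simp: graph_iso_def)
    from f(1) uv obtain a b where "a \<in> verts H" "b \<in> verts H" "f a = u" "f b = v"
      by (metis bij_betw_imp_surj_on imageE)
    with f(2) uv have "{a, b} \<in> edges H" by auto
    with that show False by (simp add: subgraph_def G_def)
  qed
  then have "rainbow_free G (\<lambda>_. 0) F"
    by (auto simp: rainbow_free_def)
  moreover have "simple_graph G" "card (verts G) = n" "proper_edge_coloring G (\<lambda>_. 0)"
    by (auto simp: G_def simple_graph_def proper_edge_coloring_def)
  ultimately show ?thesis
    unfolding rainbow_edge_counts_def by blast
qed

end

theory Submission
  imports Defs
begin

text \<open>
  Put \<open>q = 2 * s + 3\<close>.  Up to a bounded error, the extremal graphs are the disjoint unions of
  cliques \<open>K\<^bsub>q + 1\<^esub>\<close>.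

  Upper bound.  Suppose a vertex \<open>x\<close> has degree at least \<open>t + 3\<close>, and a path \<open>x, y, z\<close> starts at it.
  Among the neighbours of \<open>x\<close>, only \<open>y\<close>, \<open>z\<close> and the one joined to \<open>x\<close> in the color of \<open>yz\<close> cannot
  be used as leaves at \<open>x\<close>, so \<open>t\<close> leaves remain and a rainbow \<open>DS\<^bsub>1,t\<^esub>\<close> appears
  (\<open>not_rainbow_free_if_large_degree\<close>).  Hence, if there is no rainbow copy, every neighbour of a
  vertex of degree at least \<open>t + 3\<close> has degree one.  The components with such a vertex are stars,
  which have fewer edges than vertices, and everywhere else the degrees are at most \<open>t + 2\<close>; this
  gives at most \<open>(t + 2) * n / 2\<close> edges (\<open>card_edges_le_if_rainbow_free\<close>).

  Lower bound.  For odd \<open>q\<close> the clique \<open>K\<^bsub>q + 1\<^esub>\<close> has a proper coloring with \<open>q\<close> colors.  A copy of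
  \<open>DS\<^bsub>1,q-2\<^esub>\<close> has \<open>q\<close> edges, so a rainbow one would use every color, in particular the color of
  the edge \<open>xz\<close> from the center \<open>x\<close> of large degree to the leaf \<open>z\<close> attached at \<open>y\<close>.  But every edge
  of the double star meets \<open>xz\<close> and differs from it (\<open>rainbow_free_if_few_colors\<close>).
\<close>

section \<open>Rainbow copies as embeddings\<close>

lemma simple_graph_edgeE:
  assumes "simple_graph G" "e \<in> edges G"
  obtains u v where "e = {u, v}" "u \<noteq> v" "u \<in> verts G" "v \<in> verts G"
  using assms by (fastforce simp: simple_graph_def card_2_iff)

lemma simple_graph_edge_atE:
  assumes "simple_graph G" "e \<in> edges G" "v \<in> e"
  obtains u where "e = {v, u}"
proof -
  obtain a b where "e = {a, b}"
    using assms(1,2) by (rule simple_graph_edgeE)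
  with assms(3) have "e = {v, a} \<or> e = {v, b}"
    by auto
  with that show thesis
    by auto
qed

lemma finite_edges_simple_graph: "simple_graph G \<Longrightarrow> finite (edges G)"
  by (rule finite_subset[of _ "Pow (verts G)"]) (auto simp: simple_graph_def)

lemma not_rainbow_free_iff_embedding:
  fixes F :: "'w graph" and G :: "'v graph"
  assumes F: "simple_graph F"
  shows "\<not> rainbow_free G c F \<longleftrightarrow>
    (\<exists>h. inj_on h (verts F) \<and> h ` verts F \<subseteq> verts G \<and>
         (\<forall>e\<in>edges F. h ` e \<in> edges G) \<and> inj_on (\<lambda>e. c (h ` e)) (edges F))"
    (is "_ \<longleftrightarrow> (\<exists>h. ?emb h)")
proof
  assume "\<not> rainbow_free G c F"
  then obtain H f where H: "subgraph H G" "rainbow c H" and f: "bij_betw f (verts H) (verts F)"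
    and iso: "\<And>u v. u \<in> verts H \<Longrightarrow> v \<in> verts H \<Longrightarrow> {u, v} \<in> edges H \<longleftrightarrow> {f u, f v} \<in> edges F"
    by (auto simp: rainbow_free_def graph_iso_def)
  define h where "h = inv_into (verts H) f"
  have h: "bij_betw h (verts F) (verts H)"
    unfolding h_def by (rule bij_betw_inv_into[OF f])
  have edge: "h ` e \<in> edges H" if e: "e \<in> edges F" for e
  proof -
    obtain a b where ab: "e = {a, b}" "a \<in> verts F" "b \<in> verts F"
      using F e by (rule simple_graph_edgeE)
    have "h a \<in> verts H" "h b \<in> verts H"
      using h ab by (auto simp: bij_betw_def)
    moreover have "f (h a) = a" "f (h b) = b"
      using f ab by (auto simp: h_def bij_betw_inv_into_right)
    ultimately show ?thesis
      using iso[of "h a" "h b"] e ab by simp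
  qed
  have "edges F \<subseteq> Pow (verts F)"
    using F by (auto simp: simple_graph_def)
  then have "inj_on (image h) (edges F)"
    using h by (meson bij_betw_imp_inj_on inj_on_image_Pow inj_on_subset)
  moreover have "inj_on c (image h ` edges F)"
    using H(2) edge by (auto simp: rainbow_def intro: inj_on_subset)
  ultimately have "inj_on (\<lambda>e. c (h ` e)) (edges F)"
    using comp_inj_on[of "image h" "edges F" c] by (simp add: o_def)
  with h H(1) edge have "?emb h"
    by (auto simp: bij_betw_def subgraph_def)
  then show "\<exists>h. ?emb h"
    by blast
next
  assume "\<exists>h. ?emb h"
  then obtain h where h: "inj_on h (verts F)" "h ` verts F \<subseteq> verts G"
    "\<And>e. e \<in> edges F \<Longrightarrow> h ` e \<in> edges G" "inj_on (\<lambda>e. c (h ` e)) (edges F)"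
    by auto
  define H where "H = \<lparr>verts = h ` verts F, edges = image h ` edges F\<rparr>"
  have sub: "edges F \<subseteq> Pow (verts F)"
    using F by (auto simp: simple_graph_def)
  have "card (h ` e) = 2" if "e \<in> edges F" for e
    using F that h(1) by (metis card_image inj_on_subset simple_graph_def)
  then have "simple_graph H"
    using F by (fastforce simp: simple_graph_def H_def)
  then have "subgraph H G"
    using h by (auto simp: subgraph_def H_def)
  moreover have "rainbow c H"
    using h(4) by (auto simp: rainbow_def H_def inj_on_def)
  moreover have "graph_iso H F"
  proof -
    define f where "f = inv_into (verts F) h"
    have "bij_betw h (verts F) (verts H)"
      using h(1) by (simp add: H_def bij_betw_def)
    then have "bij_betw f (verts H) (verts F)"
      unfolding f_def by (rule bij_betw_inv_into)
    moreover have "{u, v} \<in> edges H \<longleftrightarrow> {f u, f v} \<in> edges F"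
      if uv: "u \<in> verts H" "v \<in> verts H" for u v
    proof -
      obtain a b where ab: "u = h a" "a \<in> verts F" "v = h b" "b \<in> verts F"
        using uv by (auto simp: H_def)
      then have "f u = a" "f v = b"
        using h(1) by (auto simp: f_def)
      moreover have "h ` {a, b} \<in> image h ` edges F \<longleftrightarrow> {a, b} \<in> edges F"
        using inj_on_image_mem_iff[OF inj_on_image_Pow[OF h(1)], of "{a, b}" "edges F"] sub ab
        by auto
      ultimately show ?thesis
        using ab by (simp add: H_def)
    qed
    ultimately show ?thesis
      unfolding graph_iso_def by blast
  qed
  ultimately show "\<not> rainbow_free G c F"
    unfolding rainbow_free_def by blast
qed

section \<open>The upper bound\<close>

lemma handshake:
  assumes "finite V" "finite E" "\<And>e. e \<in> E \<Longrightarrow> e \<subseteq> V \<and> card e = 2"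
  shows "(\<Sum>v\<in>V. card {e\<in>E. v \<in> e}) = 2 * card E"
proof -
  have "(\<Sum>v\<in>V. card {e\<in>E. v \<in> e}) = (\<Sum>e\<in>E. card {v\<in>V. v \<in> e})"
    using sum.swap_restrict[OF assms(1,2), of "\<lambda>_ _. 1::nat" "\<lambda>v e. v \<in> e"] by simp
  also have "\<dots> = (\<Sum>e\<in>E. 2)"
    using assms(3) by (intro sum.cong) (auto simp: Int_absorb1 simp flip: Int_def)
  finally show ?thesis by simp
qed

lemma not_rainbow_free_if_large_degree:
  assumes G: "simple_graph G" and c: "proper_edge_coloring G c"
    and xy: "{x, y} \<in> edges G" and yz: "{y, z} \<in> edges G" and "z \<noteq> x"
    and deg: "t + 3 \<le> card {v. {x, v} \<in> edges G}"
  shows "\<not> rainbow_free G c (double_star 1 t)"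
proof -
  define N where "N = {v. {x, v} \<in> edges G}"
  define B where "B = {v\<in>N. c {x, v} = c {y, z}}"
  have loopless: "{v, v} \<notin> edges G" for v
    using G by (auto simp: simple_graph_def)
  have inV: "u \<in> verts G \<and> v \<in> verts G" if "{u, v} \<in> edges G" for u v
    using G that by (fastforce simp: simple_graph_def)
  have ne: "x \<noteq> y" "y \<noteq> z" and xN: "x \<notin> N"
    using xy yz loopless by (auto simp: N_def)
  have "finite N"
    using G inV by (auto simp: N_def simple_graph_def intro: finite_subset[of _ "verts G"])
  have c_inj: "c {x, u} \<noteq> c {x, v}" if "u \<in> N" "v \<in> N" "u \<noteq> v" for u v
    using c that xN by (auto simp: proper_edge_coloring_def N_def doubleton_eq_iff)
  have "\<forall>u\<in>B. \<forall>v\<in>B. u = v"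
    using c_inj unfolding B_def by (metis (mono_tags, lifting) mem_Collect_eq)
  then have "card B \<le> 1"
    using \<open>finite N\<close> by (simp add: B_def card_le_Suc0_iff_eq)
  moreover have "card {y, z} \<le> 2"
    by (simp add: card_insert_if)
  ultimately have "card ({y, z} \<union> B) \<le> 3"
    using card_Un_le[of "{y, z}" B] by linarith
  then have "t \<le> card (N - ({y, z} \<union> B))"
    using diff_card_le_card_Diff[of "{y, z} \<union> B" N] deg \<open>finite N\<close>
    by (simp add: N_def[symmetric] B_def)
  then obtain T where T: "T \<subseteq> N - ({y, z} \<union> B)" "card T = t" "finite T"
    by (meson obtain_subset_with_card_n)
  then obtain g where g: "bij_betw g {..<t} T"
    using ex_bij_betw_nat_finite[OF T(3)] by (auto simp: lessThan_atLeast0)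
  have gT: "g i \<in> N" "g i \<noteq> y" "g i \<noteq> z" "c {x, g i} \<noteq> c {y, z}" "g i \<noteq> x" if "i < t" for i
  proof -
    have "g i \<in> T" using g that by (auto simp: bij_betw_def)
    with T(1) xN show "g i \<in> N" "g i \<noteq> y" "g i \<noteq> z" "c {x, g i} \<noteq> c {y, z}" "g i \<noteq> x"
      by (auto simp: B_def)
  qed
  have g_inj: "g i = g j \<longleftrightarrow> i = j" if "i < t" "j < t" for i j
    using g that by (auto simp: bij_betw_def inj_on_def)
  define h where "h v = (case v of CenterY \<Rightarrow> y | CenterX \<Rightarrow> x | LeafY _ \<Rightarrow> z | LeafX i \<Rightarrow> g i)" for v
  have h_simps [simp]: "h CenterY = y" "h CenterX = x" "h (LeafY j) = z" "h (LeafX i) = g i" for i j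
    by (simp_all add: h_def)
  have "inj_on h (verts (double_star 1 t))"
    using ne \<open>z \<noteq> x\<close> gT g_inj by (auto simp: double_star_def inj_on_def) metis+
  moreover have "h ` verts (double_star 1 t) \<subseteq> verts G"
    using inV[OF xy] inV[OF yz] inV[of x "g i" for i] gT by (auto simp: double_star_def N_def)
  moreover have "\<forall>e\<in>edges (double_star 1 t). h ` e \<in> edges G"
    using xy yz gT by (auto simp: double_star_def N_def insert_commute)
  moreover have "inj_on (\<lambda>e. c (h ` e)) (edges (double_star 1 t))"
  proof -
    have "y \<in> N" using xy by (simp add: N_def)
    have 1: "c {x, y} \<noteq> c {y, z}"
      using c xy yz ne \<open>z \<noteq> x\<close> by (auto simp: proper_edge_coloring_def doubleton_eq_iff)
    have 2: "c {x, g i} \<noteq> c {x, y}" if "i < t" for i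
      using c_inj gT that \<open>y \<in> N\<close> by blast
    have 3: "c {x, g i} = c {x, g j} \<longleftrightarrow> i = j" if "i < t" "j < t" for i j
      using c_inj gT g_inj that by metis
    show ?thesis
      using 1 2 3 gT(4)
      by (auto simp: inj_on_def double_star_def insert_commute) metis+
  qed
  ultimately show ?thesis
    unfolding not_rainbow_free_iff_embedding[OF simple_graph_double_star] by (intro exI[of _ h] conjI)
qed

lemma card_incident_edges:
  assumes "simple_graph G"
  shows "card {e\<in>edges G. v \<in> e} = card {u. {v, u} \<in> edges G}"
proof -
  have "{e\<in>edges G. v \<in> e} = (\<lambda>u. {v, u}) ` {u. {v, u} \<in> edges G}"
  proof (intro set_eqI iffI)
    fix e assume e: "e \<in> {e\<in>edges G. v \<in> e}"
    then obtain u where "e = {v, u}"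
      using simple_graph_edge_atE[OF assms, of e v] by auto
    with e show "e \<in> (\<lambda>u. {v, u}) ` {u. {v, u} \<in> edges G}"
      by blast
  qed auto
  moreover have "inj_on (\<lambda>u. {v, u}) {u. {v, u} \<in> edges G}"
    by (auto simp: inj_on_def doubleton_eq_iff)
  ultimately show ?thesis
    by (simp add: card_image)
qed

lemma card_edges_le_if_rainbow_free:
  assumes G: "simple_graph G" and c: "proper_edge_coloring G c"
    and free: "rainbow_free G c (double_star 1 t)"
  shows "2 * card (edges G) \<le> (t + 2) * card (verts G)"
proof -
  \<comment> \<open>The vertices of large degree, their neighbours, the edges at the former, and all other edges.\<close>
  define B where "B = {x\<in>verts G. t + 3 \<le> card {v. {x, v} \<in> edges G}}"
  define L where "L = {y. \<exists>x\<in>B. {x, y} \<in> edges G}"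
  define S where "S = {e\<in>edges G. e \<inter> B \<noteq> {}}"
  define R where "R = edges G - S"
  have fin: "finite (verts G)" "finite (edges G)"
    using G finite_edges_simple_graph by (auto simp: simple_graph_def)
  have leaf: "e = {x, y}" if "x \<in> B" "{x, y} \<in> edges G" "e \<in> edges G" "y \<in> e" for x y e
  proof (rule ccontr)
    assume "e \<noteq> {x, y}"
    with that(3,4) obtain z where "e = {y, z}" "z \<noteq> x"
      by (auto elim!: simple_graph_edgeE[OF G])
    with not_rainbow_free_if_large_degree[OF G c, of x y z t] that free show False
      by (auto simp: B_def)
  qed
  have "L \<subseteq> verts G"
    using G by (fastforce simp: L_def simple_graph_def)
  then have "finite L"
    using fin finite_subset by blast
  \<comment> \<open>An edge of \<open>S\<close> has an end in \<open>L\<close>, which by the fact \<open>leaf\<close> lies on no other edge; so \<open>S\<close> is no larger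
    than \<open>L\<close>.\<close>
  have "\<forall>e\<in>S. \<exists>y\<in>L. \<exists>x\<in>B. e = {x, y}"
  proof
    fix e assume e: "e \<in> S"
    then obtain x where "x \<in> B" "x \<in> e" "e \<in> edges G"
      by (auto simp: S_def)
    moreover from this obtain y where "e = {x, y}"
      using simple_graph_edge_atE[OF G, of e x] by auto
    ultimately show "\<exists>y\<in>L. \<exists>x\<in>B. e = {x, y}"
      unfolding L_def by blast
  qed
  then obtain l where l: "\<And>e. e \<in> S \<Longrightarrow> l e \<in> L" "\<And>e. e \<in> S \<Longrightarrow> \<exists>x\<in>B. e = {x, l e}"
    by metis
  have "inj_on l S"
  proof (rule inj_onI)
    fix e e' assume *: "e \<in> S" "e' \<in> S" "l e = l e'"
    obtain x where "x \<in> B" "e = {x, l e}"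
      using l(2)[OF *(1)] by blast
    moreover have "l e \<in> e'"
      using l(2)[OF *(2)] *(3) by auto
    ultimately show "e = e'"
      using leaf[of x "l e" e'] * by (auto simp: S_def)
  qed
  then have S: "card S \<le> card L"
    using l(1) \<open>finite L\<close> by (metis card_inj_on_le image_subsetI)
  have "2 * card R = (\<Sum>v\<in>verts G. card {e\<in>R. v \<in> e})"
    using fin G by (intro handshake[symmetric]) (auto simp: R_def simple_graph_def)
  also have "\<dots> = (\<Sum>v\<in>verts G - L. card {e\<in>R. v \<in> e})"
  proof (rule sum.mono_neutral_right)
    have no_edge: "\<not> (e \<in> R \<and> v \<in> e)" if v: "v \<in> L" for v e
    proof
      assume e: "e \<in> R \<and> v \<in> e"
      obtain x where "x \<in> B" "{x, v} \<in> edges G"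
        using v by (auto simp: L_def)
      with e leaf[of x v e] show False
        by (auto simp: R_def S_def)
    qed
    show "\<forall>v\<in>verts G - (verts G - L). card {e\<in>R. v \<in> e} = 0"
    proof
      fix v assume "v \<in> verts G - (verts G - L)"
      then have "{e\<in>R. v \<in> e} = {}"
        using no_edge by blast
      then show "card {e\<in>R. v \<in> e} = 0"
        by (simp only: card.empty)
    qed
  qed (use fin in auto)
  also have "\<dots> \<le> (\<Sum>v\<in>verts G - L. t + 2)"
  proof (rule sum_mono)
    fix v assume v: "v \<in> verts G - L"
    show "card {e\<in>R. v \<in> e} \<le> t + 2"
    proof (cases "v \<in> B")
      case True
      then have "{e\<in>R. v \<in> e} = {}"
        by (auto simp: R_def S_def)
      then show ?thesis
        by (simp only: card.empty)
    next
      case False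
      have "card {e\<in>R. v \<in> e} \<le> card {e\<in>edges G. v \<in> e}"
        using fin by (intro card_mono) (auto simp: R_def)
      with False v show ?thesis
        by (simp add: card_incident_edges[OF G] B_def)
    qed
  qed
  also have "\<dots> = (t + 2) * card (verts G - L)"
    by simp
  finally have R: "2 * card R \<le> (t + 2) * card (verts G - L)" .
  have "card (edges G) = card S + card R"
    using card_Un_disjoint[of S R] fin by (auto simp: R_def S_def Un_absorb1)
  then have "2 * card (edges G) \<le> 2 * card L + (t + 2) * card (verts G - L)"
    using S R by linarith
  also have "\<dots> \<le> (t + 2) * (card L + card (verts G - L))"
    by (simp add: algebra_simps)
  also have "card L + card (verts G - L) = card (verts G)"
    using \<open>L \<subseteq> verts G\<close> \<open>finite L\<close> fin by (simp add: card_Diff_subset card_mono)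
  finally show ?thesis .
qed

section \<open>The lower bound\<close>

lemma card_edges_double_star: "card (edges (double_star 1 t)) = t + 2"
proof -
  have "edges (double_star 1 t) =
      {{CenterY, CenterX}, {CenterY, LeafY 0}} \<union> (\<lambda>i. {CenterX, LeafX i}) ` {..<t}"
    by (auto simp: double_star_def)
  moreover have "card ((\<lambda>i. {CenterX, LeafX i}) ` {..<t}) = t"
    by (subst card_image) (auto simp: inj_on_def doubleton_eq_iff)
  moreover have "card {{CenterY, CenterX}, {CenterY, LeafY 0}} = 2"
    by (simp add: doubleton_eq_iff)
  ultimately show ?thesis
    by (simp add: card_Un_disjoint doubleton_eq_iff disjoint_iff image_iff)
qed

text \<open>The third assumption says that adjacency is transitive on distinct vertices: \<open>G\<close> is a
  disjoint union of cliques.\<close>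

lemma rainbow_free_if_few_colors:
  assumes c: "proper_edge_coloring G c"
    and colors: "c ` edges G \<subseteq> {..<t + 2}"
    and trans: "\<And>u v w. {u, v} \<in> edges G \<Longrightarrow> {v, w} \<in> edges G \<Longrightarrow> u \<noteq> w \<Longrightarrow> {u, w} \<in> edges G"
  shows "rainbow_free G c (double_star 1 t)"
proof (rule ccontr)
  let ?D = "double_star 1 t"
  assume "\<not> rainbow_free G c ?D"
  then obtain h where emb: "inj_on h (verts ?D)" "\<forall>e\<in>edges ?D. h ` e \<in> edges G"
    "inj_on (\<lambda>e. c (h ` e)) (edges ?D)"
    unfolding not_rainbow_free_iff_embedding[OF simple_graph_double_star] by (elim exE conjE)
  note h = emb(1) emb(2)[THEN bspec] emb(3)
  \<comment> \<open>An edge of \<open>G\<close> outside the copy, whose color the copy must nevertheless use.\<close>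
  define xz where "xz = {h CenterX, h (LeafY 0)}"
  have D: "{CenterX, CenterY} \<in> edges ?D" "{CenterY, LeafY 0} \<in> edges ?D"
    by (auto simp: double_star_def)
  have "h CenterX \<noteq> h (LeafY 0)"
    using h(1) by (auto simp: inj_on_def double_star_def)
  then have xz: "xz \<in> edges G"
    using trans[of "h CenterX" "h CenterY" "h (LeafY 0)"] D[THEN h(2)] by (simp add: xz_def)
  have "(\<lambda>e. c (h ` e)) ` edges ?D = {..<t + 2}"
  proof (rule card_subset_eq)
    show "(\<lambda>e. c (h ` e)) ` edges ?D \<subseteq> {..<t + 2}"
      using h(2) colors by blast
    show "card ((\<lambda>e. c (h ` e)) ` edges ?D) = card {..<t + 2}"
      using card_image[OF h(3)] card_edges_double_star[of t] by simp
  qed simp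
  then obtain e where e: "e \<in> edges ?D" "c (h ` e) = c xz"
    using xz colors by (metis (no_types, lifting) imageE image_subset_iff)
  have "h ` e \<inter> xz \<noteq> {}"
    using e(1) by (auto simp: xz_def double_star_def)
  moreover have "h ` e \<noteq> xz"
  proof
    assume "h ` e = xz"
    then have "h ` e = h ` {CenterX, LeafY 0}"
      by (simp add: xz_def)
    moreover have "e \<subseteq> verts ?D" "{CenterX, LeafY 0} \<subseteq> verts ?D"
      using e(1) by (auto simp: double_star_def)
    ultimately have "e = {CenterX, LeafY 0}"
      using h(1) by (metis inj_on_image_eq_iff)
    with e(1) show False
      by (auto simp: double_star_def doubleton_eq_iff)
  qed
  ultimately show False
    using c h(2)[OF e(1)] xz e(2) by (auto simp: proper_edge_coloring_def)
qed

text \<open>The usual coloring of the clique on \<open>{0..q}\<close> with colors \<open>{..<q}\<close>: the vertices below \<open>q\<close> are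
  the residues modulo \<open>q\<close>, the edge between \<open>i\<close> and \<open>j\<close> receives \<open>i + j\<close>, and the vertex \<open>q\<close> stands
  for infinity and is joined to \<open>i\<close> in the color \<open>2 * i\<close> that the sums leave free at \<open>i\<close>.\<close>

definition clique_color :: "nat \<Rightarrow> nat \<Rightarrow> nat \<Rightarrow> nat" where
  "clique_color q i j = ((if i = q then j else i) + (if j = q then i else j)) mod q"

lemma clique_color_commute: "clique_color q i j = clique_color q j i"
  by (simp add: clique_color_def add.commute)

lemma add_mod_left_cancel:
  fixes a j k q :: nat
  assumes "(a + j) mod q = (a + k) mod q" "j < q" "k < q"
  shows "j = k"
proof -
  have "(int a + int j) mod int q = (int a + int k) mod int q"
    using assms(1) by (metis of_nat_add of_nat_mod)
  then have "int j mod int q = int k mod int q"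
    by (metis mod_diff_left_eq add_diff_cancel_left')
  with assms(2,3) show ?thesis
    by simp
qed

lemma double_mod_odd_cancel:
  fixes j k q :: nat
  assumes "odd q" "(j + j) mod q = (k + k) mod q" "j < q" "k < q"
  shows "j = k"
proof -
  have "int q dvd 2 * (int j - int k)"
    using assms(2) by (metis mod_eq_dvd_iff mult_2 of_nat_add of_nat_mod right_diff_distrib)
  moreover have "coprime (int q) 2"
    using assms(1) by simp
  ultimately have "int q dvd int j - int k"
    by (metis coprime_dvd_mult_right_iff)
  then have "int j mod int q = int k mod int q"
    by (simp add: mod_eq_dvd_iff)
  with assms(3,4) show ?thesis
    by simp
qed

lemma clique_color_inj:
  assumes q: "odd q" and le: "i \<le> q" "j \<le> q" "k \<le> q" and ne: "i \<noteq> j" "i \<noteq> k"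
    and eq: "clique_color q i j = clique_color q i k"
  shows "j = k"
proof -
  consider "i = q" | "i \<noteq> q" "j = q" | "i \<noteq> q" "k = q" | "i < q" "j < q" "k < q"
    using le by linarith
  then show ?thesis
  proof cases
    case 1
    then show ?thesis
      using double_mod_odd_cancel[OF q, of j k] eq le ne by (auto simp: clique_color_def)
  next
    case 2
    then show ?thesis
      using add_mod_left_cancel[of i i q k] eq le ne
      by (cases "k = q") (auto simp: clique_color_def)
  next
    case 3
    then show ?thesis
      using add_mod_left_cancel[of i j q i] eq le ne
      by (cases "j = q") (auto simp: clique_color_def)
  next
    case 4
    then show ?thesis
      using add_mod_left_cancel[of i j q k] eq by (auto simp: clique_color_def)
  qed
qed

text \<open>The vertices are cut into consecutive blocks of length \<open>k\<close>, the last one possibly incomplete,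
  and each block spans a clique.\<close>

definition clique_blocks :: "nat \<Rightarrow> nat \<Rightarrow> nat graph" where
  "clique_blocks k n =
     \<lparr>verts = {..<n}, edges = {{u, v} | u v. u < n \<and> v < n \<and> u \<noteq> v \<and> u div k = v div k}\<rparr>"

lemma clique_blocks_edge_iff:
  "{u, v} \<in> edges (clique_blocks k n) \<longleftrightarrow> u < n \<and> v < n \<and> u \<noteq> v \<and> u div k = v div k"
  by (auto simp: clique_blocks_def doubleton_eq_iff)

lemma simple_graph_clique_blocks: "simple_graph (clique_blocks k n)"
  by (auto simp: simple_graph_def clique_blocks_def)

lemma clique_blocks_coloring:
  assumes q: "odd q"
  obtains c where "proper_edge_coloring (clique_blocks (q + 1) n) c"
    "c ` edges (clique_blocks (q + 1) n) \<subseteq> {..<q}"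
proof
  let ?G = "clique_blocks (q + 1) n"
  define c where "c e = clique_color q (Min e mod (q + 1)) (Max e mod (q + 1))" for e
  have c_eq: "c {u, v} = clique_color q (u mod (q + 1)) (v mod (q + 1))" for u v
    by (cases "u \<le> v") (auto simp: c_def clique_color_commute max_def min_def)
  show "proper_edge_coloring ?G c"
    unfolding proper_edge_coloring_def
  proof (intro ballI impI notI)
    fix e e' assume e: "e \<in> edges ?G" "e' \<in> edges ?G" "e \<noteq> e' \<and> e \<inter> e' \<noteq> {}" "c e = c e'"
    obtain u where u: "u \<in> e" "u \<in> e'"
      using e(3) by blast
    obtain v where v: "e = {u, v}"
      using simple_graph_clique_blocks e(1) u(1) by (rule simple_graph_edge_atE)
    obtain w where w: "e' = {u, w}"
      using simple_graph_clique_blocks e(2) u(2) by (rule simple_graph_edge_atE)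
    have div: "u div (q + 1) = v div (q + 1)" "u div (q + 1) = w div (q + 1)" "u \<noteq> v" "u \<noteq> w"
      using e(1,2) v w by (simp_all add: clique_blocks_edge_iff)
    have inj: "a = b" if "a div (q + 1) = b div (q + 1)" "a mod (q + 1) = b mod (q + 1)" for a b
      using that by (metis div_mult_mod_eq)
    have "v mod (q + 1) = w mod (q + 1)"
    proof (rule clique_color_inj[OF q])
      show "u mod (q + 1) \<le> q" "v mod (q + 1) \<le> q" "w mod (q + 1) \<le> q"
        using mod_less_divisor[of "q + 1"] by (simp_all add: less_Suc_eq_le)
      show "u mod (q + 1) \<noteq> v mod (q + 1)" "u mod (q + 1) \<noteq> w mod (q + 1)"
        using inj[of u v] inj[of u w] div by blast+
      show "clique_color q (u mod (q + 1)) (v mod (q + 1)) =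
          clique_color q (u mod (q + 1)) (w mod (q + 1))"
        using e(4) v w by (simp only: c_eq)
    qed
    then have "v = w"
      using inj[of v w] div by simp
    with e(3) v w show False by simp
  qed
  show "c ` edges ?G \<subseteq> {..<q}"
    using odd_pos[OF q] by (auto simp: c_def clique_color_def)
qed

lemma card_edges_clique_blocks:
  fixes q n :: nat
  shows "q * n \<le> 2 * card (edges (clique_blocks (q + 1) n)) + q * (q + 1)"
proof -
  let ?G = "clique_blocks (q + 1) n"
  \<comment> \<open>The number of vertices in complete blocks.\<close>
  let ?m = "(q + 1) * (n div (q + 1))"
  have m: "?m \<le> n" "n \<le> ?m + (q + 1)"
    using mod_less_divisor[of "q + 1" n] mult_div_mod_eq[of "q + 1" n] by linarith+
  have deg: "card {e\<in>edges ?G. v \<in> e} = q" if v: "v < ?m" for v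
  proof -
    let ?b = "v div (q + 1) * (q + 1)"
    have b: "?b \<le> v" "v < ?b + (q + 1)"
      using mod_less_divisor[of "q + 1" v] div_mult_mod_eq[of v "q + 1"] by linarith+
    have "v div (q + 1) < n div (q + 1)"
      using v by (simp add: less_mult_imp_div_less mult.commute)
    then have "Suc (v div (q + 1)) * (q + 1) \<le> n div (q + 1) * (q + 1)"
      by (intro mult_le_mono1) simp
    then have bn: "?b + (q + 1) \<le> n"
      using m(1) by (simp add: algebra_simps)
    have block: "u div (q + 1) = v div (q + 1) \<longleftrightarrow> ?b \<le> u \<and> u < ?b + (q + 1)" for u
    proof
      assume "u div (q + 1) = v div (q + 1)"
      then have "u = ?b + u mod (q + 1)"
        by (metis div_mult_mod_eq)
      with mod_less_divisor[of "q + 1" u] show "?b \<le> u \<and> u < ?b + (q + 1)"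
        by linarith
    next
      assume "?b \<le> u \<and> u < ?b + (q + 1)"
      then show "u div (q + 1) = v div (q + 1)"
        by (intro div_nat_eqI) (simp_all add: algebra_simps)
    qed
    have "{v, u} \<in> edges ?G \<longleftrightarrow> u \<in> {?b..<?b + (q + 1)} - {v}" for u
    proof -
      have "{v, u} \<in> edges ?G \<longleftrightarrow> u \<noteq> v \<and> v < n \<and> u < n \<and> u div (q + 1) = v div (q + 1)"
        unfolding clique_blocks_edge_iff by metis
      also have "\<dots> \<longleftrightarrow> u \<noteq> v \<and> ?b \<le> u \<and> u < ?b + (q + 1)"
        unfolding block using b bn by linarith
      finally show ?thesis
        by (simp only: Diff_iff atLeastLessThan_iff singleton_iff conj_commute)
    qed
    then have "{u. {v, u} \<in> edges ?G} = {?b..<?b + (q + 1)} - {v}"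
      by blast
    then have "card {u. {v, u} \<in> edges ?G} = q"
      using b by simp
    then show ?thesis
      by (simp add: card_incident_edges[OF simple_graph_clique_blocks])
  qed
  have "q * ?m = (\<Sum>v<?m. card {e\<in>edges ?G. v \<in> e})"
    using deg by simp
  also have "\<dots> \<le> (\<Sum>v<n. card {e\<in>edges ?G. v \<in> e})"
    using m(1) by (intro sum_mono2) auto
  also have "\<dots> = 2 * card (edges ?G)"
    using simple_graph_clique_blocks[of "q + 1" n]
    by (intro handshake finite_edges_simple_graph) (auto simp: simple_graph_def clique_blocks_def)
  finally have "q * ?m \<le> 2 * card (edges ?G)" .
  moreover have "q * n \<le> q * ?m + q * (q + 1)"
    using mult_le_mono2[OF m(2), of q] by (simp only: distrib_left)
  ultimately show ?thesis
    by linarith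
qed

section \<open>The rainbow Turan number\<close>

theorem theorem4p11:
  fixes s :: nat
  shows "(\<lambda>n::nat. real (rainbow_turan n (double_star 1 (2 * s + 1)))
                     - real (2 * s + 3) * real n / 2) \<in> O(\<lambda>_. 1)"
proof (rule bigoI[where c = "real ((2 * s + 3) * (2 * s + 3 + 1)) / 2"], rule always_eventually, rule allI)
  fix n :: nat
  let ?D = "double_star 1 (2 * s + 1)" and ?q = "2 * s + 3"
  let ?C = "rainbow_edge_counts n ?D" and ?G = "clique_blocks (?q + 1) n"
  obtain c where c: "proper_edge_coloring ?G c" "c ` edges ?G \<subseteq> {..<?q}"
    by (rule clique_blocks_coloring[of ?q n]) simp_all
  have "c ` edges ?G \<subseteq> {..<(2 * s + 1) + 2}"
    using c(2) by (simp add: numeral_3_eq_3)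
  with c(1) have "rainbow_free ?G c ?D"
    by (rule rainbow_free_if_few_colors) (simp add: clique_blocks_edge_iff)
  moreover have "card (verts ?G) = n"
    by (simp add: clique_blocks_def)
  ultimately have mem: "card (edges ?G) \<in> ?C"
    unfolding rainbow_edge_counts_def using simple_graph_clique_blocks c(1) by blast
  have "2 * m \<le> ?q * n" if m: "m \<in> ?C" for m
  proof -
    obtain G :: "nat graph" and c where G: "m = card (edges G)" "simple_graph G"
      "card (verts G) = n" "proper_edge_coloring G c" "rainbow_free G c ?D"
      using m unfolding rainbow_edge_counts_def mem_Collect_eq by (elim exE conjE)
    have "2 * m \<le> ((2 * s + 1) + 2) * n"
      using card_edges_le_if_rainbow_free[OF G(2,4,5)] unfolding G(1,3) .
    also have "(2 * s + 1) + 2 = ?q"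
      by simp
    finally show ?thesis .
  qed
  moreover have "rainbow_turan n ?D \<in> ?C"
    unfolding rainbow_turan_def using mem Max_in[OF finite_rainbow_edge_counts] by (metis empty_iff)
  ultimately have upper: "2 * rainbow_turan n ?D \<le> ?q * n"
    by blast
  have "card (edges ?G) \<le> rainbow_turan n ?D"
    unfolding rainbow_turan_def using mem by (intro Max_ge finite_rainbow_edge_counts)
  then have lower: "?q * n \<le> 2 * rainbow_turan n ?D + ?q * (?q + 1)"
    using card_edges_clique_blocks[of ?q n] by linarith
  have "real (2 * rainbow_turan n ?D) \<le> real (?q * n)"
    using upper by (simp only: of_nat_le_iff)
  moreover have "real (?q * n) \<le> real (2 * rainbow_turan n ?D + ?q * (?q + 1))"
    using lower by (simp only: of_nat_le_iff)
  ultimately have "\<bar>real (rainbow_turan n ?D) - real ?q * real n / 2\<bar> \<le> real (?q * (?q + 1)) / 2"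
    unfolding abs_le_iff of_nat_add[of "2 * _"] of_nat_mult[of _ n] of_nat_mult[of 2 "rainbow_turan _ _"]
      of_nat_numeral by linarith
  then show "norm (real (rainbow_turan n ?D) - real ?q * real n / 2)
      \<le> real (?q * (?q + 1)) / 2 * norm (1 :: real)"
    by (simp only: norm_one mult_1_right real_norm_def)
qed

end
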